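(* Consider a discrete-time quasi-birth-and-death process (QBD) as described in the context, assumed irreducible and positive recurrent. For $z>0$ let $A(z)=\frac1z A_{-1}+A_0+zA_1$, let $\sigma(z)$ be the Perron–Frobenius eigenvalue of $A(z)$ and $\boldsymbol{u}(z)$ a corresponding strictly positive right eigenvector. Let $z_0$ be the minimal solution of $\sigma'(z)=0$ with $z>1$. Define the vector $\boldsymbol{v}$ on the state space by its level-$i$ subvectors $\boldsymbol{v}_i=z_0^i\,\boldsymbol{u}(z_0)$, $i\ge0$, and let $\lambda_0=\sigma(z_0)$, $C=\ell(0)$ and $$b=\max_{1\le j\le m}\big(B\boldsymbol{v}_0+A_1\boldsymbol{v}_1-\lambda_0\boldsymbol{v}_0\big)_j.$$ Then the drift condition $\mathbf{D}(\boldsymbol{v},\lambda_0,b,C)$ holds.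
   Context: A QBD is a Markov chain $\{X_t\}$ on $\mathbb{E}=\bigcup_{n\ge0}\ell(n)$, $\ell(n)=\{(n,j):1\le j\le m\}$, $m<\infty$, with transition matrix in block form (blocks indexed by levels) whose nonzero blocks are $P_{00}=B$, $P_{01}=A_1$, and for $n\ge1$: $P_{n,n-1}=A_{-1}$, $P_{nn}=A_0$, $P_{n,n+1}=A_1$, where $A_{-1},A_0,A_1,B$ are nonnegative $m\times m$ matrices. Standing assumptions: the chain is irreducible and $A=A_{-1}+A_0+A_1$ is irreducible. Positive recurrence is equivalent to $\boldsymbol{\mu}(A_{-1}-A_1)\boldsymbol{1}>0$, where $\boldsymbol{\mu}$ is the stationary probability vector of $A$. Drift condition $\mathbf{D}(\boldsymbol{v},\lambda,b,C)$: $\boldsymbol{v}$ is a finite vector on $\mathbb{E}$ bounded away from zero, $\lambda\in(0,1)$, $b<\infty$, $C\subset\mathbb{E}$ finite, and $P\boldsymbol{v}\le\lambda\boldsymbol{v}+b\,\mathbb{1}[C]$ componentwise, where $\mathbb{1}[C]$ is the indicator vector of $C$. *)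

theory Defs
  imports "HOL-Analysis.Analysis"
begin

text \<open>States of the QBD: pairs (level n, phase j), phases indexed by a finite type 'm.\<close>

definition qbd_P ::
  "real^'m^'m \<Rightarrow> real^'m^'m \<Rightarrow> real^'m^'m \<Rightarrow> real^'m^'m
     \<Rightarrow> (nat \<times> 'm) \<Rightarrow> (nat \<times> 'm) \<Rightarrow> real" where
  "qbd_P B Am1 A0 A1 x y =
     (case x of (n, i) \<Rightarrow> case y of (n', j) \<Rightarrow>
        if n = 0 then (if n' = 0 then B$i$j else if n' = 1 then A1$i$j else 0)
        else if n' + 1 = n then Am1$i$j
        else if n' = n then A0$i$j
        else if n' = n + 1 then A1$i$j
        else 0)"

definition nonneg_mat :: "real^'m^'m \<Rightarrow> bool" where
  "nonneg_mat M \<longleftrightarrow> (\<forall>i j. 0 \<le> M$i$j)"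

text \<open>Irreducibility of a nonnegative matrix: every phase reaches every phase
  in the directed graph of positive entries.\<close>
definition irreducible_mat :: "real^'m^'m \<Rightarrow> bool" where
  "irreducible_mat M \<longleftrightarrow> (\<forall>i j. (i, j) \<in> {(k, l). 0 < M$k$l}\<^sup>*)"

text \<open>Irreducibility of a Markov chain with transition kernel P.\<close>
definition irreducible_chain :: "('s \<Rightarrow> 's \<Rightarrow> real) \<Rightarrow> bool" where
  "irreducible_chain P \<longleftrightarrow> (\<forall>x y. (x, y) \<in> {(a, b). 0 < P a b}\<^sup>*)"

text \<open>Spectral radius (= Perron--Frobenius eigenvalue for irreducible nonnegative
  matrices): the largest modulus of a complex eigenvalue.\<close>
definition spectral_radius :: "real^'m^'m \<Rightarrow> real" where
  "spectral_radius M =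
     Max {cmod c | c. det (mat c - (\<chi> i j. complex_of_real (M$i$j))) = 0}"

definition qbd_Az :: "real^'m^'m \<Rightarrow> real^'m^'m \<Rightarrow> real^'m^'m \<Rightarrow> real \<Rightarrow> real^'m^'m" where
  "qbd_Az Am1 A0 A1 z = (1 / z) *\<^sub>R Am1 + A0 + z *\<^sub>R A1"

text \<open>Drift condition D(v, lambda, b, C).\<close>
definition drift_cond ::
  "('s \<Rightarrow> 's \<Rightarrow> real) \<Rightarrow> ('s \<Rightarrow> real) \<Rightarrow> real \<Rightarrow> real \<Rightarrow> 's set \<Rightarrow> bool" where
  "drift_cond P v lam b C \<longleftrightarrow>
     (\<exists>\<epsilon>>0. \<forall>x. \<epsilon> \<le> v x) \<and> 0 < lam \<and> lam < 1 \<and> finite C \<and>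
     (\<forall>x. (\<lambda>y. P x y * v y) summable_on UNIV \<and>
          (\<Sum>\<^sub>\<infinity>y. P x y * v y) \<le> lam * v x + b * indicator C x)"

end

theory Submission
  imports Defs "HOL-Computational_Algebra.Fundamental_Theorem_Algebra"
begin

text \<open>For \<open>v\<^sub>i = z0\<^sup>i u(z0)\<close> the drift inequality holds with equality at every level
  \<open>n \<ge> 1\<close>, because \<open>u(z0)\<close> is an eigenvector of \<open>A(z0)\<close>; level \<open>0\<close> is absorbed into \<open>b\<close>.
  What has to be shown is \<open>\<lambda>0 = \<sigma>(z0) < 1\<close>.  Suppose \<open>\<lambda>0 \<ge> 1\<close>.  Testing \<open>A(z0\<^sup>a)\<close>,
  \<open>1/2 \<le> a \<le> 1\<close>, against the componentwise power \<open>u\<^sup>a\<close> and using concavity of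
  \<open>t \<mapsto> t\<^sup>a\<close> gives \<open>A(z0\<^sup>a) u\<^sup>a \<le> (\<lambda>0 - (1 - a) E) u\<^sup>a\<close> with \<open>E \<ge> 0\<close>.  Positive recurrence
  makes \<open>E\<close> nonzero somewhere, irreducibility spreads that deficit to all phases after
  \<open>N\<close> steps, and the Collatz--Wielandt bound turns this into
  \<open>\<sigma>(z0\<^sup>a)\<^sup>N \<le> \<lambda>0\<^sup>N - (1 - a) \<kappa>\<close>.  Hence \<open>\<sigma>(z) \<le> \<lambda>0 - c (z0 - z)\<close> just left of \<open>z0\<close>, which
  contradicts \<open>\<sigma>'(z0) = 0\<close>.\<close>

section \<open>Iterates of nonnegative matrices\<close>

lemma matrix_vector_mult_mono:
  fixes M :: "real^'n^'n"
  assumes "nonneg_mat M" "y \<le> w"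
  shows "M *v y \<le> M *v w"
  using assms by (auto simp: less_eq_vec_def matrix_vector_mult_def nonneg_mat_def
      intro!: sum_mono mult_left_mono)

lemma iterate_mono:
  fixes M :: "real^'n^'n"
  assumes "nonneg_mat M" "y \<le> w"
  shows "((*v) M ^^ n) y \<le> ((*v) M ^^ n) w"
  by (induction n) (auto simp: assms matrix_vector_mult_mono)

lemma iterate_scaleR: "((*v) M ^^ n) (t *\<^sub>R x) = t *\<^sub>R ((*v) M ^^ n) x"
  for M :: "real^'n^'n"
  by (induction n) (auto simp: vec_eq_iff matrix_vector_mult_def sum_distrib_left algebra_simps)

lemma iterate_le_pow:
  fixes M :: "real^'n^'n"
  assumes nonneg: "nonneg_mat M" and sub: "M *v x \<le> lam *\<^sub>R x" and "0 \<le> lam"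
  shows "((*v) M ^^ n) x \<le> lam ^ n *\<^sub>R x"
proof (induction n)
  case (Suc n)
  have "((*v) M ^^ Suc n) x \<le> M *v (lam ^ n *\<^sub>R x)"
    using Suc nonneg by (simp add: matrix_vector_mult_mono)
  also have "\<dots> = lam ^ n *\<^sub>R (M *v x)"
    by (simp add: vec_eq_iff matrix_vector_mult_def sum_distrib_left algebra_simps)
  also have "\<dots> \<le> lam ^ n *\<^sub>R (lam *\<^sub>R x)"
    using sub \<open>0 \<le> lam\<close> by (simp add: less_eq_vec_def mult.assoc mult_left_mono)
  finally show ?case by (simp add: mult.commute)
qed simp

lemma iterate_deficit_Suc:
  fixes M :: "real^'n^'n"
  assumes nonneg: "nonneg_mat M" and sub: "M *v x \<le> lam *\<^sub>R x" and "1 \<le> lam"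
    and "0 \<le> d" "0 \<le> x$j"
    and deficit: "(((*v) M ^^ n) x)$j \<le> (lam ^ n - d) * x$j"
  shows "(((*v) M ^^ Suc n) x)$j \<le> (lam ^ Suc n - d) * x$j"
proof -
  have "(((*v) M ^^ Suc n) x)$j = (((*v) M ^^ n) (M *v x))$j"
    by (simp add: funpow_Suc_right del: funpow.simps)
  also have "\<dots> \<le> lam * (((*v) M ^^ n) x)$j"
    using iterate_mono[OF nonneg sub, of n] by (simp add: less_eq_vec_def iterate_scaleR)
  also have "\<dots> \<le> lam * ((lam ^ n - d) * x$j)"
    using deficit \<open>1 \<le> lam\<close> by (simp add: mult_left_mono)
  also have "\<dots> \<le> (lam ^ Suc n - d) * x$j"
    using \<open>1 \<le> lam\<close> mult_right_mono[OF \<open>1 \<le> lam\<close> mult_nonneg_nonneg[OF \<open>0 \<le> d\<close> \<open>0 \<le> x$j\<close>]]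
    by (simp add: algebra_simps)
  finally show ?thesis .
qed

lemma iterate_deficit_add:
  fixes M :: "real^'n^'n"
  assumes "nonneg_mat M" "M *v x \<le> lam *\<^sub>R x" "1 \<le> lam" "0 \<le> d" "0 \<le> x$j"
    and "(((*v) M ^^ n) x)$j \<le> (lam ^ n - d) * x$j"
  shows "(((*v) M ^^ (n + k)) x)$j \<le> (lam ^ (n + k) - d) * x$j"
  by (induction k) (use assms iterate_deficit_Suc[of M x lam d j] in \<open>simp_all del: funpow.simps\<close>)

lemma iterate_deficit_edge:
  fixes M :: "real^'n^'n"
  assumes nonneg: "nonneg_mat M" and sub: "M *v x \<le> lam *\<^sub>R x" and "0 \<le> lam" "0 \<le> d"
    and deficit: "(((*v) M ^^ n) x)$k \<le> (lam ^ n - d) * x$k"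
    and edge: "\<delta> * x$j \<le> M$j$k * x$k"
  shows "(((*v) M ^^ Suc n) x)$j \<le> (lam ^ Suc n - d * \<delta>) * x$j"
proof -
  define w where "w = lam ^ n *\<^sub>R x - (d * x$k) *\<^sub>R axis k 1"
  have "((*v) M ^^ n) x \<le> w"
    using iterate_le_pow[OF nonneg sub \<open>0 \<le> lam\<close>, of n] deficit
    by (auto simp: less_eq_vec_def w_def axis_def algebra_simps)
  then have "(((*v) M ^^ Suc n) x)$j \<le> (M *v w)$j"
    using matrix_vector_mult_mono[OF nonneg] by (simp add: less_eq_vec_def)
  also have "\<dots> = lam ^ n * (M *v x)$j - d * (M$j$k * x$k)"
    by (simp add: w_def matrix_vector_mult_def axis_def sum_distrib_left sum_subtractf
        mult_delta_right algebra_simps)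
  also have "\<dots> \<le> lam ^ n * (lam * x$j) - d * (\<delta> * x$j)"
    using sub edge \<open>0 \<le> lam\<close> \<open>0 \<le> d\<close>
    by (intro diff_mono mult_left_mono) (auto simp: less_eq_vec_def)
  finally show ?thesis by (simp add: algebra_simps)
qed

context
  fixes M :: "'a \<Rightarrow> real^'n^'n" and x :: "'a \<Rightarrow> real^'n" and I :: "'a set"
    and s :: "'a \<Rightarrow> real" and E :: "'n \<Rightarrow> real" and R :: "('n \<times> 'n) set" and lam :: real
  assumes lam: "1 \<le> lam"
    and nonneg: "\<And>a. a \<in> I \<Longrightarrow> nonneg_mat (M a)"
    and x_nonneg: "\<And>a. a \<in> I \<Longrightarrow> 0 \<le> x a"
    and s_nonneg: "\<And>a. a \<in> I \<Longrightarrow> 0 \<le> s a"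
    and E_nonneg: "\<And>j. 0 \<le> E j"
    and row_deficit: "\<And>a j. a \<in> I \<Longrightarrow> (M a *v x a)$j \<le> (lam - s a * E j) * x a $ j"
    and edge: "\<And>j k. (j, k) \<in> R \<Longrightarrow> \<exists>\<delta>>0. \<forall>a\<in>I. \<delta> * x a $ j \<le> M a $ j $ k * x a $ k"
    and strongly_connected: "\<And>j k. (j, k) \<in> R\<^sup>*"
begin

private lemma sub_invariant: "a \<in> I \<Longrightarrow> M a *v x a \<le> lam *\<^sub>R x a"
  using row_deficit s_nonneg E_nonneg x_nonneg
  by (fastforce simp: less_eq_vec_def intro: order.trans[OF row_deficit] mult_right_mono)

private lemma iterate_deficit_reaches:
  assumes "0 < E g"
  shows "\<exists>n \<kappa>. 0 < n \<and> 0 < \<kappa> \<and>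
           (\<forall>a\<in>I. (((*v) (M a) ^^ n) (x a))$j \<le> (lam ^ n - s a * \<kappa>) * x a $ j)"
  using strongly_connected[of j g]
proof (induction rule: converse_rtrancl_induct)
  case base
  show ?case using assms row_deficit by (intro exI[of _ "1::nat"] exI[of _ "E g"]) simp
next
  case (step j k)
  then obtain n \<kappa> where n\<kappa>: "0 < n" "0 < \<kappa>"
    "\<forall>a\<in>I. (((*v) (M a) ^^ n) (x a))$k \<le> (lam ^ n - s a * \<kappa>) * x a $ k" by blast
  obtain \<delta> where \<delta>: "0 < \<delta>" "\<forall>a\<in>I. \<delta> * x a $ j \<le> M a $ j $ k * x a $ k"
    using edge[OF step(1)] by blast
  have "(((*v) (M a) ^^ Suc n) (x a))$j \<le> (lam ^ Suc n - s a * \<kappa> * \<delta>) * x a $ j"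
    if "a \<in> I" for a
    using lam s_nonneg[OF that] n\<kappa> \<delta> that
    by (intro iterate_deficit_edge[OF nonneg[OF that] sub_invariant[OF that]]) auto
  then show ?case using n\<kappa> \<delta> by (intro exI[of _ "Suc n"] exI[of _ "\<kappa> * \<delta>"]) (simp add: mult.assoc)
qed

lemma uniform_iterate_deficit:
  assumes "0 < E g"
  obtains N \<kappa> where "0 < N" "0 < \<kappa>"
    "\<And>a j. a \<in> I \<Longrightarrow> (((*v) (M a) ^^ N) (x a))$j \<le> (lam ^ N - s a * \<kappa>) * x a $ j"
proof -
  obtain n \<kappa> where n\<kappa>: "\<And>j. 0 < n j" "\<And>j. 0 < \<kappa> j"
    "\<And>a j. a \<in> I \<Longrightarrow> (((*v) (M a) ^^ n j) (x a))$j \<le> (lam ^ n j - s a * \<kappa> j) * x a $ j"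
    using iterate_deficit_reaches[OF assms] by metis
  define N where "N = Max (range n)"
  define \<kappa>0 where "\<kappa>0 = Min (range \<kappa>)"
  have N_ge: "n j \<le> N" and \<kappa>0_le: "\<kappa>0 \<le> \<kappa> j" for j unfolding N_def \<kappa>0_def by auto
  have "0 < N" using n\<kappa>(1) N_ge by (meson less_le_trans)
  moreover have "0 < \<kappa>0" unfolding \<kappa>0_def using n\<kappa>(2) by (auto intro: Min_in)
  moreover have "(((*v) (M a) ^^ N) (x a))$j \<le> (lam ^ N - s a * \<kappa>0) * x a $ j"
    if "a \<in> I" for a j
  proof -
    have "(((*v) (M a) ^^ (n j + (N - n j))) (x a))$j \<le> (lam ^ (n j + (N - n j)) - s a * \<kappa> j) * x a $ j"
      using that n\<kappa> n\<kappa>(2)[THEN less_imp_le] s_nonneg x_nonneg lam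
      by (intro iterate_deficit_add[OF nonneg sub_invariant]) (auto simp: less_eq_vec_def)
    also have "\<dots> \<le> (lam ^ N - s a * \<kappa>0) * x a $ j"
      using N_ge[of j] \<kappa>0_le[of j] that s_nonneg x_nonneg
      by (intro mult_right_mono) (auto simp: less_eq_vec_def mult_left_mono)
    finally show ?thesis using N_ge[of j] by simp
  qed
  ultimately show ?thesis using that by blast
qed

end

section \<open>Spectral radius of nonnegative matrices\<close>

definition charpoly :: "'a::comm_ring_1^'n^'n \<Rightarrow> 'a poly" where
  "charpoly N = det (\<chi> i j. if i = j then [:- (N$i$j), 1:] else [:- (N$i$j):])"

lemma poly_charpoly: "poly (charpoly N) c = det (mat c - N)"
proof -
  have "poly (if i = j then [:- (N$i$j), 1:] else [:- (N$i$j):]) c = (mat c - N)$i$j" for i j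
    by (simp add: mat_def)
  then show ?thesis
    unfolding charpoly_def det_def
    by (simp add: poly_sum poly_prod of_int_poly del: vector_minus_component)
qed

lemma coeff_charpoly_card: "coeff (charpoly N) CARD('n) = 1"
  for N :: "'a::idom^'n^'n"
proof -
  let ?e = "\<lambda>i j. if i = j then [:- (N$i$j), 1:] else [:- (N$i$j):]"
  let ?t = "\<lambda>p. of_int (sign p) * (\<Prod>i\<in>UNIV. ?e i (p i))"
  have perms: "finite {p. p permutes (UNIV::'n set)}" "id \<in> {p. p permutes (UNIV::'n set)}"
    by (simp_all add: finite_permutations)
  have off_diagonal: "coeff (?t p) CARD('n) = 0" if "p \<noteq> id" for p
  proof -
    obtain i0 where i0: "p i0 \<noteq> i0" using \<open>p \<noteq> id\<close> by (metis eq_id_iff)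
    have "degree (\<Prod>i\<in>UNIV. ?e i (p i)) \<le> (\<Sum>i\<in>UNIV. degree (?e i (p i)))"
      using degree_prod_sum_le[of UNIV "\<lambda>i. ?e i (p i)"] by (simp add: o_def)
    also have "\<dots> = degree (?e i0 (p i0)) + (\<Sum>i\<in>UNIV - {i0}. degree (?e i (p i)))"
      by (simp add: sum.remove)
    also have "\<dots> \<le> 0 + (\<Sum>i\<in>UNIV - {i0}. 1)"
      using i0 by (intro add_mono sum_mono) auto
    also have "\<dots> < CARD('n)"
      using zero_less_card_finite[where 'a='n] by (simp add: card_Diff_singleton)
    finally show ?thesis by (simp add: of_int_poly coeff_eq_0)
  qed
  have diagonal: "coeff (?t id) CARD('n) = 1"
  proof -
    have "degree (\<Prod>i\<in>(UNIV::'n set). [:- (N$i$i), 1:]) = CARD('n)"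
      by (subst degree_prod_eq_sum_degree) auto
    moreover have "lead_coeff (\<Prod>i\<in>(UNIV::'n set). [:- (N$i$i), 1:]) = 1"
      by (simp add: lead_coeff_prod)
    ultimately show ?thesis by simp
  qed
  have "coeff (charpoly N) CARD('n) = (\<Sum>p\<in>{p. p permutes UNIV}. coeff (?t p) CARD('n))"
    unfolding charpoly_def det_def by (simp add: coeff_sum)
  also have "\<dots> = 1"
    using off_diagonal diagonal by (simp add: sum.remove[OF perms])
  finally show ?thesis .
qed

lemma eigenvalues_finite_nonempty:
  fixes N :: "complex^'n^'n"
  shows "finite {c. det (mat c - N) = 0}" "{c. det (mat c - N) = 0} \<noteq> {}"
proof -
  have "charpoly N \<noteq> 0" "degree (charpoly N) \<ge> CARD('n)"
    using coeff_charpoly_card[of N] by (auto simp: le_degree)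
  then have "degree (charpoly N) \<noteq> 0"
    using zero_less_card_finite[where 'a='n] by linarith
  then have "\<not> constant (poly (charpoly N))"
    by (simp add: constant_degree)
  from fundamental_theorem_of_algebra[OF this] show "{c. det (mat c - N) = 0} \<noteq> {}"
    by (auto simp: poly_charpoly)
  show "finite {c. det (mat c - N) = 0}"
    using poly_roots_finite[OF \<open>charpoly N \<noteq> 0\<close>] by (simp add: poly_charpoly)
qed

lemma eigenvector_exists:
  fixes N :: "complex^'n^'n"
  assumes "det (mat c - N) = 0"
  obtains y where "y \<noteq> 0" "N *v y = c *s y"
proof -
  have "\<not> inj ((*v) (mat c - N))"
    using det_nz_iff_inj_gen[of "(*v) (mat c - N)"] assms by simp
  then obtain a b where ab: "a \<noteq> b" "(mat c - N) *v a = (mat c - N) *v b"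
    unfolding inj_def by blast
  have "mat c *v v = c *s v" for v :: "complex^'n"
    by (simp add: vec_eq_iff matrix_vector_mult_def mat_def mult_delta_left)
  moreover have "(mat c - N) *v (a - b) = 0"
    using ab(2) by (simp add: matrix_vector_mult_diff_distrib)
  ultimately have "N *v (a - b) = c *s (a - b)"
    by (simp add: matrix_vector_mult_diff_rdistrib)
  with ab(1) show ?thesis by (intro that[of "a - b"]) auto
qed

definition of_real_mat :: "real^'n^'n \<Rightarrow> complex^'n^'n" where
  "of_real_mat M = (\<chi> i j. complex_of_real (M$i$j))"

lemma spectral_radius_attained:
  obtains c where "det (mat c - of_real_mat M) = 0" "spectral_radius M = cmod c"
proof -
  have "{cmod c | c. det (mat c - (\<chi> i j. complex_of_real (M$i$j))) = 0}
      = cmod ` {c. det (mat c - of_real_mat M) = 0}" by (auto simp: of_real_mat_def)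
  then have "spectral_radius M \<in> cmod ` {c. det (mat c - of_real_mat M) = 0}"
    unfolding spectral_radius_def using eigenvalues_finite_nonempty[of "of_real_mat M"]
    by (auto intro!: Max_in)
  then show ?thesis using that by auto
qed

lemma spectral_radius_nonneg: "0 \<le> spectral_radius M"
  by (metis norm_ge_zero spectral_radius_attained)

lemma norm_eigenvalue_pow_le_iterate:
  fixes M :: "real^'n^'n"
  assumes nonneg: "nonneg_mat M" and eig: "of_real_mat M *v y = c *s y"
  defines "a \<equiv> \<chi> j. cmod (y$j)"
  shows "cmod c ^ n *\<^sub>R a \<le> ((*v) M ^^ n) a"
proof (induction n)
  case (Suc n)
  have "cmod c * a$j \<le> (M *v a)$j" for j
  proof -
    have "cmod c * a$j = cmod ((of_real_mat M *v y)$j)" using eig by (simp add: a_def norm_mult)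
    also have "\<dots> \<le> (M *v a)$j"
      unfolding matrix_vector_mult_def of_real_mat_def a_def using nonneg
      by (auto simp: nonneg_mat_def norm_mult intro!: order.trans[OF norm_sum] sum_mono)
    finally show ?thesis .
  qed
  then have "cmod c ^ n * (cmod c * a$j) \<le> cmod c ^ n * (M *v a)$j" for j
    by (simp add: mult_left_mono)
  then have "cmod c ^ Suc n *\<^sub>R a \<le> cmod c ^ n *\<^sub>R (M *v a)"
    by (simp add: less_eq_vec_def algebra_simps)
  also have "\<dots> = M *v (cmod c ^ n *\<^sub>R a)"
    by (simp add: vec_eq_iff matrix_vector_mult_def sum_distrib_left algebra_simps)
  also have "\<dots> \<le> ((*v) M ^^ Suc n) a"
    using Suc nonneg by (simp add: matrix_vector_mult_mono)
  finally show ?case .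
qed simp

text \<open>Collatz--Wielandt bound: compare \<open>|y|\<close>, for an eigenvector \<open>y\<close> of an eigenvalue of
  maximal modulus, with the smallest multiple of \<open>x\<close> dominating it.\<close>
lemma spectral_radius_pow_le:
  fixes M :: "real^'n^'n"
  assumes nonneg: "nonneg_mat M" and x_pos: "\<forall>j. 0 < x$j"
    and bound: "((*v) M ^^ K) x \<le> \<gamma> *\<^sub>R x"
  shows "spectral_radius M ^ K \<le> \<gamma>"
proof -
  obtain c where c: "det (mat c - of_real_mat M) = 0" "spectral_radius M = cmod c"
    by (rule spectral_radius_attained)
  obtain y where y: "y \<noteq> 0" "of_real_mat M *v y = c *s y"
    using eigenvector_exists[OF c(1)] by blast
  define a where "a = (\<chi> j. cmod (y$j))"
  define t where "t = Max (range (\<lambda>j. a$j / x$j))"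
  have "t \<in> range (\<lambda>j. a$j / x$j)" unfolding t_def by (rule Max_in) auto
  then obtain j0 where j0: "t = a$j0 / x$j0" by blast
  have "a$j / x$j \<le> t" for j unfolding t_def by (rule Max_ge) auto
  then have a_le: "a \<le> t *\<^sub>R x"
    using x_pos by (simp add: less_eq_vec_def divide_le_eq)
  obtain k where "y$k \<noteq> 0" using y(1) by (metis vec_eq_iff zero_index)
  then have "0 < a$k / x$k" using x_pos by (simp add: a_def)
  also have "\<dots> \<le> t" unfolding t_def by (rule Max_ge) auto
  finally have "0 < t * x$j0" using x_pos by simp
  moreover have "cmod c ^ K * (t * x$j0) \<le> \<gamma> * (t * x$j0)"
  proof -
    have "cmod c ^ K * a$j0 \<le> (((*v) M ^^ K) a)$j0"
      using norm_eigenvalue_pow_le_iterate[OF nonneg y(2), of K] by (simp add: a_def less_eq_vec_def)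
    also have "\<dots> \<le> t * (((*v) M ^^ K) x)$j0"
      using iterate_mono[OF nonneg a_le, of K] by (simp add: less_eq_vec_def iterate_scaleR)
    also have "\<dots> \<le> t * (\<gamma> * x$j0)"
      using bound \<open>0 < t * x$j0\<close> x_pos[rule_format, of j0]
      by (intro mult_left_mono) (auto simp: less_eq_vec_def zero_less_mult_iff)
    finally show ?thesis using j0 x_pos[rule_format, of j0] by (simp add: algebra_simps)
  qed
  ultimately show ?thesis unfolding c(2) by (meson mult_le_cancel_right_pos)
qed

section \<open>Elementary real inequalities\<close>

definition amgm_gap :: "real \<Rightarrow> real" where
  "amgm_gap t = (1 + t) / 2 - sqrt t"

lemma amgm_gap_eq_square: "0 \<le> t \<Longrightarrow> amgm_gap t = (sqrt t - 1)\<^sup>2 / 2"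
  by (simp add: amgm_gap_def power2_eq_square algebra_simps)

lemma amgm_gap_nonneg: "0 \<le> t \<Longrightarrow> 0 \<le> amgm_gap t"
  by (simp add: amgm_gap_eq_square)

lemma amgm_gap_eq_0_iff: "0 \<le> t \<Longrightarrow> amgm_gap t = 0 \<longleftrightarrow> t = 1"
  by (auto simp: amgm_gap_eq_square)

text \<open>Convexity of \<open>a \<mapsto> t\<^sup>a\<close> on \<open>[1/2, 1]\<close>; writing \<open>\<surd>t = (1 + t)/2 - amgm_gap t\<close> shows how
  much this improves on the chord through \<open>a = 0\<close>.\<close>
lemma powr_le_chord_minus_amgm_gap:
  fixes t a :: real
  assumes "0 < t" "1/2 \<le> a" "a \<le> 1"
  shows "t powr a \<le> (1 - a) + a * t - 2 * (1 - a) * amgm_gap t"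
proof -
  have "exp ((1 - (2*a-1)) *\<^sub>R (ln t / 2) + (2*a-1) *\<^sub>R ln t)
        \<le> (1 - (2*a-1)) * exp (ln t / 2) + (2*a-1) * exp (ln t)"
    using convex_onD[OF exp_convex, of "2*a-1" "ln t / 2" "ln t"] assms by simp
  moreover have "(1 - (2*a-1)) *\<^sub>R (ln t / 2) + (2*a-1) *\<^sub>R ln t = a * ln t"
    by (simp add: algebra_simps)
  moreover have "exp (ln t / 2) = sqrt t"
    using assms by (simp add: powr_half_sqrt[symmetric] powr_def)
  ultimately have "t powr a \<le> (2 - 2*a) * sqrt t + (2*a-1) * t"
    using assms by (simp add: powr_def)
  then show ?thesis by (simp add: amgm_gap_def field_simps)
qed

lemma sum_powr_le_chord_minus_amgm_gap:
  fixes w t :: "'k \<Rightarrow> real"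
  assumes "\<And>k. k \<in> K \<Longrightarrow> 0 \<le> w k" "\<And>k. k \<in> K \<Longrightarrow> 0 < t k" "1/2 \<le> a" "a \<le> 1"
  shows "(\<Sum>k\<in>K. w k * t k powr a)
     \<le> (1 - a) * (\<Sum>k\<in>K. w k) + a * (\<Sum>k\<in>K. w k * t k) - 2 * (1 - a) * (\<Sum>k\<in>K. w k * amgm_gap (t k))"
proof -
  have "(\<Sum>k\<in>K. w k * t k powr a)
      \<le> (\<Sum>k\<in>K. w k * ((1 - a) + a * t k - 2 * (1 - a) * amgm_gap (t k)))"
    using assms powr_le_chord_minus_amgm_gap by (intro sum_mono mult_left_mono) auto
  also have "\<dots> = (1 - a) * (\<Sum>k\<in>K. w k) + a * (\<Sum>k\<in>K. w k * t k)
      - 2 * (1 - a) * (\<Sum>k\<in>K. w k * amgm_gap (t k))"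
    by (simp add: algebra_simps sum.distrib sum_subtractf sum_distrib_left)
  finally show ?thesis .
qed

lemma min_one_le_powr:
  fixes r a :: real
  assumes "0 < r" "0 \<le> a" "a \<le> 1"
  shows "min 1 r \<le> r powr a"
proof (cases "1 \<le> r")
  case True then show ?thesis using assms ge_one_powr_ge_zero by simp
next
  case False
  then have "r powr 1 \<le> r powr a" using assms by (intro powr_mono') auto
  then show ?thesis using False assms by simp
qed

lemma le_of_pow_le_pow_minus:
  fixes lam s eps :: real
  assumes lam: "1 \<le> lam" and "0 < N" "0 \<le> s" "0 \<le> eps"
    and pow_le: "s ^ N \<le> lam ^ N - eps"
  shows "s \<le> lam - eps / (real N * lam ^ (N - 1))"
proof -
  obtain M where M: "N = Suc M" using \<open>0 < N\<close> not0_implies_Suc by blast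
  define eta where "eta = eps / (real N * lam ^ M)"
  have "0 < lam ^ M" "0 \<le> s ^ N" using lam \<open>0 \<le> s\<close> by simp_all
  have "eta \<le> (lam * lam ^ M) / (real N * lam ^ M)"
    unfolding eta_def using pow_le \<open>0 \<le> s ^ N\<close> \<open>0 < lam ^ M\<close> \<open>0 < N\<close> M
    by (intro divide_right_mono) auto
  also have "\<dots> \<le> lam" using \<open>0 < lam ^ M\<close> \<open>0 < N\<close> lam by (simp add: divide_le_eq)
  finally have "eta \<le> lam" .
  have "real N * eta = eps / lam ^ M" unfolding eta_def using \<open>0 < N\<close> by simp
  then have "lam ^ N - eps = lam ^ N * (1 + real N * (- eta / lam))"
    using M lam \<open>0 < lam ^ M\<close> by (simp add: field_simps)
  also have "\<dots> \<le> lam ^ N * (1 + - eta / lam) ^ N"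
    using Bernoulli_inequality[of "- eta / lam" N] \<open>eta \<le> lam\<close> lam
    by (intro mult_left_mono) auto
  also have "\<dots> = (lam - eta) ^ N"
    using lam by (simp add: power_mult_distrib[symmetric] field_simps)
  finally have "s ^ N \<le> (lam - eta) ^ N" using pow_le by simp
  then have "s \<le> lam - eta"
    using power_le_imp_le_base[of s M "lam - eta"] \<open>eta \<le> lam\<close> M by simp
  then show ?thesis by (simp add: eta_def M)
qed

lemma log_ratio_exponent:
  fixes z z0 :: real
  assumes z0: "1 < z0" and z: "sqrt z0 \<le> z" "z < z0"
  defines "a \<equiv> ln z / ln z0"
  shows "1/2 \<le> a" "a < 1" "z0 powr a = z" "(z0 - z) / (z0 * ln z0) \<le> 1 - a"
proof -
  have L: "0 < ln z0" using z0 by simp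
  have zpos: "0 < z" using z z0 by (smt (verit) real_sqrt_gt_zero)
  have "ln z0 / 2 \<le> ln z" using z zpos z0 by (simp flip: ln_sqrt)
  then show "1/2 \<le> a" unfolding a_def using L by (simp add: field_simps)
  have "ln z < ln z0" using z zpos by simp
  then show "a < 1" unfolding a_def using L by simp
  show "z0 powr a = z" unfolding a_def using L z0 zpos by (simp add: powr_def)
  have "1 - z / z0 \<le> ln z0 - ln z"
    using ln_le_minus_one[of "z / z0"] zpos z0 by (simp add: ln_div)
  then have "(z0 - z) / z0 / ln z0 \<le> (ln z0 - ln z) / ln z0"
    using L z0 by (intro divide_right_mono) (auto simp: field_simps)
  then show "(z0 - z) / (z0 * ln z0) \<le> 1 - a" unfolding a_def using L by (simp add: field_simps)
qed

lemma no_linear_rise_to_critical_point: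
  fixes f :: "real \<Rightarrow> real"
  assumes "(f has_real_derivative 0) (at z0)" "0 < c" "w < z0"
    and rise: "\<And>z. w \<le> z \<Longrightarrow> z < z0 \<Longrightarrow> f z \<le> f z0 - c * (z0 - z)"
  shows False
proof -
  have "((\<lambda>z. f z - (c/2) * z) has_real_derivative (0 - c/2)) (at z0)"
    using assms(1) by (auto intro!: derivative_eq_intros)
  then obtain d where "0 < d" and
    dec: "\<And>h. 0 < h \<Longrightarrow> h < d \<Longrightarrow> f z0 - (c/2) * z0 < f (z0 - h) - (c/2) * (z0 - h)"
    using DERIV_neg_dec_left[of _ _ z0] \<open>0 < c\<close> by force
  define h where "h = min (d/2) (z0 - w)"
  have "0 < h" "h < d" using \<open>0 < d\<close> \<open>w < z0\<close> by (auto simp: h_def)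
  have "f (z0 - h) \<le> f z0 - c * h"
    using rise[of "z0 - h"] \<open>0 < h\<close> by (simp add: h_def)
  with dec[OF \<open>0 < h\<close> \<open>h < d\<close>] have "c * h < (c/2) * h"
    by (simp add: field_simps)
  with \<open>0 < h\<close> \<open>0 < c\<close> show False by simp
qed

section \<open>The matrix function \<open>A(z)\<close>\<close>

lemma qbd_Az_entry: "qbd_Az Am1 A0 A1 z $ j $ k = Am1$j$k / z + A0$j$k + z * A1$j$k"
  by (simp add: qbd_Az_def)

lemma nonneg_qbd_Az:
  assumes "nonneg_mat Am1" "nonneg_mat A0" "nonneg_mat A1" "0 < z"
  shows "nonneg_mat (qbd_Az Am1 A0 A1 z)"
  using assms by (auto simp: nonneg_mat_def qbd_Az_entry)

definition qbd_amgm_defect ::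
  "real^'m^'m \<Rightarrow> real^'m^'m \<Rightarrow> real^'m^'m \<Rightarrow> real \<Rightarrow> real^'m \<Rightarrow> 'm \<Rightarrow> real" where
  "qbd_amgm_defect Am1 A0 A1 z u j =
     (\<Sum>k\<in>UNIV. Am1$j$k * amgm_gap (u$k / (z * u$j)) + A0$j$k * amgm_gap (u$k / u$j)
       + A1$j$k * amgm_gap (z * u$k / u$j))"

lemma qbd_amgm_defect_nonneg:
  assumes "nonneg_mat Am1" "nonneg_mat A0" "nonneg_mat A1" "0 < z" "\<forall>j. 0 < u$j"
  shows "0 \<le> qbd_amgm_defect Am1 A0 A1 z u j"
  using assms less_imp_le[of 0 "u$k" for k] unfolding qbd_amgm_defect_def nonneg_mat_def
  by (auto intro!: sum_nonneg add_nonneg_nonneg mult_nonneg_nonneg amgm_gap_nonneg)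

lemma qbd_Az_powr_row:
  fixes Am1 A0 A1 :: "real^'m^'m" and u :: "real^'m"
  assumes "0 < z0" and u_pos: "\<forall>j. 0 < u$j"
  shows "(qbd_Az Am1 A0 A1 (z0 powr a) *v (\<chi> k. u$k powr a))$j
    = u$j powr a * ((\<Sum>k\<in>UNIV. Am1$j$k * (u$k / (z0 * u$j)) powr a)
        + (\<Sum>k\<in>UNIV. A0$j$k * (u$k / u$j) powr a) + (\<Sum>k\<in>UNIV. A1$j$k * (z0 * u$k / u$j) powr a))"
proof -
  have "0 < u$j powr a" "0 < z0 powr a" "u$j \<noteq> 0"
    using u_pos[rule_format, of j] \<open>0 < z0\<close> by auto
  then have "qbd_Az Am1 A0 A1 (z0 powr a) $ j $ k * u$k powr a
      = u$j powr a * (Am1$j$k * (u$k / (z0 * u$j)) powr a + A0$j$k * (u$k / u$j) powr a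
        + A1$j$k * (z0 * u$k / u$j) powr a)" for k
    using u_pos[rule_format, of k] \<open>0 < z0\<close>
    by (simp add: qbd_Az_entry powr_divide powr_mult field_simps)
  then show ?thesis
    by (simp add: matrix_vector_mult_def sum_distrib_left[symmetric] sum.distrib)
qed

text \<open>With \<open>u\<^sup>a\<close> the componentwise power, each entry of \<open>A(z0\<^sup>a) u\<^sup>a\<close> is a weighted sum of \<open>a\<close>-th powers of the ratios that make up
  \<open>(A(z0) u)\<^sub>j / u\<^sub>j = \<lambda>\<close>, with weights summing to \<open>1\<close>.\<close>
lemma qbd_Az_powr_test_vector:
  fixes Am1 A0 A1 :: "real^'m^'m" and u :: "real^'m"
  assumes nonneg: "nonneg_mat Am1" "nonneg_mat A0" "nonneg_mat A1"
    and stoch: "\<forall>i. (\<Sum>j\<in>UNIV. Am1$i$j + A0$i$j + A1$i$j) = 1"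
    and "0 < z0" and u_pos: "\<forall>j. 0 < u$j"
    and eig: "qbd_Az Am1 A0 A1 z0 *v u = lam *\<^sub>R u"
    and a: "1/2 \<le> a" "a \<le> 1"
  shows "(qbd_Az Am1 A0 A1 (z0 powr a) *v (\<chi> k. u$k powr a))$j
     \<le> (lam - (1 - a) * (lam - 1 + 2 * qbd_amgm_defect Am1 A0 A1 z0 u j)) * u$j powr a"
proof -
  define tm t0 tp where "tm k = u$k / (z0 * u$j)" and "t0 k = u$k / u$j" and "tp k = z0 * u$k / u$j"
    for k
  let ?S = "\<lambda>f. \<Sum>k\<in>UNIV. f k"
  have t_pos: "0 < tm k" "0 < t0 k" "0 < tp k" for k
    using u_pos \<open>0 < z0\<close> by (auto simp: tm_def t0_def tp_def)
  have "(qbd_Az Am1 A0 A1 (z0 powr a) *v (\<chi> k. u$k powr a))$j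
      = u$j powr a * (?S (\<lambda>k. Am1$j$k * tm k powr a) + ?S (\<lambda>k. A0$j$k * t0 k powr a)
                      + ?S (\<lambda>k. A1$j$k * tp k powr a))"
    unfolding qbd_Az_powr_row[OF \<open>0 < z0\<close> u_pos] tm_def t0_def tp_def ..
  also have "\<dots> \<le> u$j powr a * ((1 - a) * ?S (\<lambda>k. Am1$j$k + A0$j$k + A1$j$k)
        + a * (?S (\<lambda>k. Am1$j$k * tm k) + ?S (\<lambda>k. A0$j$k * t0 k) + ?S (\<lambda>k. A1$j$k * tp k))
        - 2 * (1 - a) * qbd_amgm_defect Am1 A0 A1 z0 u j)"
    using sum_powr_le_chord_minus_amgm_gap[OF _ _ a, of UNIV "\<lambda>k. Am1$j$k" tm]
      sum_powr_le_chord_minus_amgm_gap[OF _ _ a, of UNIV "\<lambda>k. A0$j$k" t0]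
      sum_powr_le_chord_minus_amgm_gap[OF _ _ a, of UNIV "\<lambda>k. A1$j$k" tp]
      nonneg t_pos u_pos
    by (intro mult_left_mono)
      (auto simp: nonneg_mat_def qbd_amgm_defect_def tm_def t0_def tp_def sum.distrib algebra_simps)
  also have "?S (\<lambda>k. Am1$j$k * tm k) + ?S (\<lambda>k. A0$j$k * t0 k) + ?S (\<lambda>k. A1$j$k * tp k) = lam"
  proof -
    have "u$j * (?S (\<lambda>k. Am1$j$k * tm k) + ?S (\<lambda>k. A0$j$k * t0 k) + ?S (\<lambda>k. A1$j$k * tp k))
        = (qbd_Az Am1 A0 A1 z0 *v u)$j"
      using qbd_Az_powr_row[OF \<open>0 < z0\<close> u_pos, of Am1 A0 A1 1 j] \<open>0 < z0\<close>
        abs_of_pos[of "u$k" for k] u_pos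
      by (simp add: tm_def t0_def tp_def abs_mult)
    then show ?thesis using eig u_pos[rule_format, of j] by simp
  qed
  finally show ?thesis using stoch by (simp add: algebra_simps)
qed

lemma qbd_Az_entry_ge:
  assumes nonneg: "nonneg_mat Am1" "nonneg_mat A0" "nonneg_mat A1" and "1 \<le> z" "z \<le> z0"
  shows "(Am1 + A0 + A1)$j$k / z0 \<le> qbd_Az Am1 A0 A1 z $ j $ k"
proof -
  have shrink: "c / z0 \<le> c" if "0 \<le> c" for c
    using that assms by (simp add: divide_le_eq mult_le_cancel_left1)
  have "Am1$j$k / z0 \<le> Am1$j$k / z"
    using assms by (simp add: nonneg_mat_def divide_left_mono)
  moreover have "A0$j$k / z0 \<le> A0$j$k"
    using nonneg shrink by (simp add: nonneg_mat_def)
  moreover have "A1$j$k / z0 \<le> z * A1$j$k"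
  proof -
    have "0 \<le> A1$j$k" using nonneg by (simp add: nonneg_mat_def)
    then have "A1$j$k / z0 \<le> A1$j$k" by (rule shrink)
    also have "\<dots> \<le> z * A1$j$k"
      using \<open>0 \<le> A1$j$k\<close> \<open>1 \<le> z\<close> mult_right_mono[of 1 z "A1$j$k"] by simp
    finally show ?thesis .
  qed
  ultimately show ?thesis by (simp add: qbd_Az_entry add_divide_distrib)
qed

lemma qbd_Az_powr_entry_ge:
  assumes nonneg: "nonneg_mat Am1" "nonneg_mat A0" "nonneg_mat A1"
    and "1 < z0" and u_pos: "\<forall>j. 0 < u$j" and "0 \<le> a" "a \<le> 1"
  shows "(Am1 + A0 + A1)$j$k / z0 * min 1 (u$k / u$j) * u$j powr a
      \<le> qbd_Az Am1 A0 A1 (z0 powr a) $ j $ k * u$k powr a"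
proof -
  have "1 \<le> z0 powr a" "z0 powr a \<le> z0"
    using assms ge_one_powr_ge_zero[of z0 a] powr_mono[of a 1 z0] by auto
  then have entry: "(Am1 + A0 + A1)$j$k / z0 \<le> qbd_Az Am1 A0 A1 (z0 powr a) $ j $ k"
    using qbd_Az_entry_ge[OF nonneg] by blast
  have "min 1 (u$k / u$j) \<le> (u$k / u$j) powr a"
    using u_pos assms by (intro min_one_le_powr) auto
  then have ratio: "min 1 (u$k / u$j) * u$j powr a \<le> u$k powr a"
    using u_pos[rule_format, of j] u_pos[rule_format, of k]
    by (simp add: powr_divide le_divide_eq)
  have "0 \<le> qbd_Az Am1 A0 A1 (z0 powr a) $ j $ k"
    using nonneg_qbd_Az[OF nonneg, of "z0 powr a"] \<open>1 < z0\<close> by (simp add: nonneg_mat_def)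
  moreover have "0 \<le> min 1 (u$k / u$j) * u$j powr a"
    using u_pos[rule_format, of j] u_pos[rule_format, of k] by simp
  ultimately show ?thesis using mult_mono[OF entry ratio] by (simp only: mult.assoc)
qed

lemma qbd_amgm_defect_eq_0_imp:
  assumes nonneg: "nonneg_mat Am1" "nonneg_mat A0" "nonneg_mat A1"
    and "0 < z" and u_pos: "\<forall>j. 0 < u$j" and zero: "qbd_amgm_defect Am1 A0 A1 z u j = 0"
  shows "Am1$j$k \<noteq> 0 \<Longrightarrow> u$k = z * u$j"
    and "A0$j$k \<noteq> 0 \<Longrightarrow> u$k = u$j"
    and "A1$j$k \<noteq> 0 \<Longrightarrow> u$j = z * u$k"
proof -
  define gm g0 gp where "gm k = Am1$j$k * amgm_gap (u$k / (z * u$j))"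
    and "g0 k = A0$j$k * amgm_gap (u$k / u$j)" and "gp k = A1$j$k * amgm_gap (z * u$k / u$j)" for k
  have ratios: "0 \<le> u$k / (z * u$j)" "0 \<le> u$k / u$j" "0 \<le> z * u$k / u$j" for k
    using u_pos[rule_format, of j] u_pos[rule_format, of k] \<open>0 < z\<close> by auto
  then have terms_nonneg: "0 \<le> gm k" "0 \<le> g0 k" "0 \<le> gp k" for k
    using nonneg by (auto simp: gm_def g0_def gp_def nonneg_mat_def
        intro!: mult_nonneg_nonneg amgm_gap_nonneg)
  have "(\<Sum>k\<in>UNIV. gm k + g0 k + gp k) = 0"
    using zero by (simp add: gm_def g0_def gp_def qbd_amgm_defect_def)
  then have "gm k + g0 k + gp k = 0"
    using terms_nonneg by (subst (asm) sum_nonneg_eq_0_iff) (auto intro: add_nonneg_nonneg)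
  then have "gm k = 0" "g0 k = 0" "gp k = 0" using terms_nonneg[of k] by linarith+
  then show "Am1$j$k \<noteq> 0 \<Longrightarrow> u$k = z * u$j" "A0$j$k \<noteq> 0 \<Longrightarrow> u$k = u$j"
    "A1$j$k \<noteq> 0 \<Longrightarrow> u$j = z * u$k"
    using ratios[of k] u_pos[rule_format, of j] \<open>0 < z\<close>
    by (auto simp: gm_def g0_def gp_def amgm_gap_eq_0_iff field_simps)
qed

lemma qbd_amgm_defect_eq_0_ln_entry:
  fixes Am1 A0 A1 :: "real^'m^'m" and u :: "real^'m"
  assumes nonneg: "nonneg_mat Am1" "nonneg_mat A0" "nonneg_mat A1"
    and "0 < z" and u_pos: "\<forall>j. 0 < u$j" and zero: "qbd_amgm_defect Am1 A0 A1 z u j = 0"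
  shows "(Am1 + A0 + A1)$j$k * ln (u$k)
      = ln (u$j) * (Am1$j$k + A0$j$k + A1$j$k) + ln z * (Am1$j$k - A1$j$k)"
proof -
  have pos: "0 < u$j" "0 < u$k" using u_pos by auto
  note eq = qbd_amgm_defect_eq_0_imp[OF nonneg \<open>0 < z\<close> u_pos zero, of k]
  have "Am1$j$k * ln (u$k) = Am1$j$k * (ln (u$j) + ln z)"
    using eq(1) pos \<open>0 < z\<close> by (cases "Am1$j$k = 0") (simp_all add: ln_mult)
  moreover have "A0$j$k * ln (u$k) = A0$j$k * ln (u$j)"
    using eq(2) by (cases "A0$j$k = 0") simp_all
  moreover have "A1$j$k * ln (u$j) = A1$j$k * (ln (u$k) + ln z)"
    using eq(3) pos \<open>0 < z\<close> by (cases "A1$j$k = 0") (simp_all add: ln_mult)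
  ultimately show ?thesis unfolding vector_add_component by algebra
qed

text \<open>If every defect vanished, \<open>ln u\<close> would rise by exactly \<open>ln z0\<close> along every
  \<open>A\<^sub>-\<^sub>1\<close>-transition, fall by \<open>ln z0\<close> along every \<open>A\<^sub>1\<close>-transition and stay put along
  \<open>A\<^sub>0\<close>; averaging against \<open>\<mu>\<close> then forces zero mean drift, contradicting positive
  recurrence.\<close>
lemma qbd_amgm_defect_not_all_zero:
  fixes Am1 A0 A1 :: "real^'m^'m" and u mu :: "real^'m"
  assumes nonneg: "nonneg_mat Am1" "nonneg_mat A0" "nonneg_mat A1"
    and stoch: "\<forall>i. (\<Sum>j\<in>UNIV. Am1$i$j + A0$i$j + A1$i$j) = 1"
    and mu: "mu v* (Am1 + A0 + A1) = mu"
    and pos_rec: "mu \<bullet> ((Am1 - A1) *v (\<chi> j. 1)) > 0"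
    and "1 < z0" and u_pos: "\<forall>j. 0 < u$j"
  obtains g where "qbd_amgm_defect Am1 A0 A1 z0 u g \<noteq> 0"
proof (rule ccontr)
  assume "\<not> thesis"
  with that have zero: "qbd_amgm_defect Am1 A0 A1 z0 u j = 0" for j by blast
  define w where "w = (\<chi> k. ln (u$k))"
  have "((Am1 + A0 + A1) *v w)$j
      = w$j * (\<Sum>k\<in>UNIV. Am1$j$k + A0$j$k + A1$j$k) + ln z0 * (\<Sum>k\<in>UNIV. Am1$j$k - A1$j$k)" for j
    using qbd_amgm_defect_eq_0_ln_entry[OF nonneg _ u_pos zero] \<open>1 < z0\<close>
    by (simp add: w_def matrix_vector_mult_def sum.distrib sum_distrib_left[symmetric]
        del: vector_add_component)
  then have "(Am1 + A0 + A1) *v w = w + ln z0 *\<^sub>R ((Am1 - A1) *v (\<chi> j. 1))"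
    using stoch by (simp add: vec_eq_iff matrix_vector_mult_def)
  then have "mu \<bullet> w = mu \<bullet> w + ln z0 * (mu \<bullet> ((Am1 - A1) *v (\<chi> j. 1)))"
    using dot_lmul_matrix[of mu "Am1 + A0 + A1" w] mu by (simp add: inner_add_right)
  then show False using pos_rec \<open>1 < z0\<close> by simp
qed

section \<open>The Perron--Frobenius eigenvalue at the critical point\<close>

lemma qbd_Az_powr_iterate_deficit:
  fixes Am1 A0 A1 :: "real^'m^'m" and u mu :: "real^'m"
  assumes nonneg: "nonneg_mat Am1" "nonneg_mat A0" "nonneg_mat A1"
    and stoch: "\<forall>i. (\<Sum>j\<in>UNIV. Am1$i$j + A0$i$j + A1$i$j) = 1"
    and irr: "irreducible_mat (Am1 + A0 + A1)"
    and mu: "mu v* (Am1 + A0 + A1) = mu"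
    and pos_rec: "mu \<bullet> ((Am1 - A1) *v (\<chi> j. 1)) > 0"
    and "1 < z0" and u_pos: "\<forall>j. 0 < u$j"
    and eig: "qbd_Az Am1 A0 A1 z0 *v u = lam *\<^sub>R u" and "1 \<le> lam"
  obtains N \<kappa> where "0 < N" "0 < \<kappa>"
    "\<And>a. a \<in> {1/2..1} \<Longrightarrow> ((*v) (qbd_Az Am1 A0 A1 (z0 powr a)) ^^ N) (\<chi> k. u$k powr a)
        \<le> (lam ^ N - (1 - a) * \<kappa>) *\<^sub>R (\<chi> k. u$k powr a)"
proof -
  define E where "E j = lam - 1 + 2 * qbd_amgm_defect Am1 A0 A1 z0 u j" for j
  have defect_nonneg: "0 \<le> qbd_amgm_defect Am1 A0 A1 z0 u j" for j
    using qbd_amgm_defect_nonneg[OF nonneg _ u_pos] \<open>1 < z0\<close> by simp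
  obtain g where "qbd_amgm_defect Am1 A0 A1 z0 u g \<noteq> 0"
    using qbd_amgm_defect_not_all_zero[OF nonneg stoch mu pos_rec \<open>1 < z0\<close> u_pos] .
  then have "0 < E g" using defect_nonneg[of g] \<open>1 \<le> lam\<close> by (simp add: E_def)
  have edge: "\<exists>\<delta>>0. \<forall>a\<in>{1/2..1}. \<delta> * (\<chi> k. u$k powr a) $ j
      \<le> qbd_Az Am1 A0 A1 (z0 powr a) $ j $ k * (\<chi> k. u$k powr a) $ k"
    if "(j, k) \<in> {(k, l). 0 < (Am1 + A0 + A1)$k$l}" for j k
    using that u_pos \<open>1 < z0\<close> qbd_Az_powr_entry_ge[OF nonneg \<open>1 < z0\<close> u_pos]
    by (intro exI[of _ "(Am1 + A0 + A1)$j$k / z0 * min 1 (u$k / u$j)"]) auto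
  have row_deficit: "(qbd_Az Am1 A0 A1 (z0 powr a) *v (\<chi> k. u$k powr a))$j
      \<le> (lam - (1 - a) * E j) * (\<chi> k. u$k powr a) $ j" if "a \<in> {1/2..1}" for a j
    using qbd_Az_powr_test_vector[OF nonneg stoch _ u_pos eig] that \<open>1 < z0\<close> by (simp add: E_def)
  have "nonneg_mat (qbd_Az Am1 A0 A1 (z0 powr a))" if "a \<in> {1/2..1}" for a
    using nonneg_qbd_Az[OF nonneg] \<open>1 < z0\<close> by simp
  moreover have "0 \<le> (\<chi> k. u$k powr a)" if "a \<in> {1/2..1}" for a :: real
    by (simp add: less_eq_vec_def)
  moreover have "0 \<le> 1 - a" if "a \<in> {1/2..1}" for a :: real
    using that by simp
  moreover have "0 \<le> E j" for j
    using defect_nonneg[of j] \<open>1 \<le> lam\<close> by (simp add: E_def)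
  moreover have "(j, k) \<in> {(k, l). 0 < (Am1 + A0 + A1)$k$l}\<^sup>*" for j k
    using irr by (simp add: irreducible_mat_def)
  ultimately obtain N \<kappa> where "0 < N" "0 < \<kappa>"
    "\<And>a j. a \<in> {1/2..1} \<Longrightarrow> (((*v) (qbd_Az Am1 A0 A1 (z0 powr a)) ^^ N) (\<chi> k. u$k powr a))$j
        \<le> (lam ^ N - (1 - a) * \<kappa>) * (\<chi> k. u$k powr a) $ j"
    using uniform_iterate_deficit[where M="\<lambda>a. qbd_Az Am1 A0 A1 (z0 powr a)"
        and x="\<lambda>a. \<chi> k. u$k powr a" and I="{1/2..1}" and s="\<lambda>a. 1 - a" and E=E
        and R="{(k, l). 0 < (Am1 + A0 + A1)$k$l}" and lam=lam and g=g,
        OF \<open>1 \<le> lam\<close> _ _ _ _ row_deficit edge _ \<open>0 < E g\<close>]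
    by metis
  then show ?thesis using that by (auto simp: less_eq_vec_def)
qed

lemma qbd_spectral_radius_linear_rise:
  fixes Am1 A0 A1 :: "real^'m^'m" and u mu :: "real^'m"
  assumes nonneg: "nonneg_mat Am1" "nonneg_mat A0" "nonneg_mat A1"
    and stoch: "\<forall>i. (\<Sum>j\<in>UNIV. Am1$i$j + A0$i$j + A1$i$j) = 1"
    and irr: "irreducible_mat (Am1 + A0 + A1)"
    and mu: "mu v* (Am1 + A0 + A1) = mu"
    and pos_rec: "mu \<bullet> ((Am1 - A1) *v (\<chi> j. 1)) > 0"
    and "1 < z0" and u_pos: "\<forall>j. 0 < u$j"
    and eig: "qbd_Az Am1 A0 A1 z0 *v u = lam *\<^sub>R u" and "1 \<le> lam"
  obtains c where "0 < c"
    "\<And>z. sqrt z0 \<le> z \<Longrightarrow> z < z0 \<Longrightarrow> spectral_radius (qbd_Az Am1 A0 A1 z) \<le> lam - c * (z0 - z)"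
proof -
  obtain N \<kappa> where "0 < N" "0 < \<kappa>" and deficit:
    "\<And>a. a \<in> {1/2..1} \<Longrightarrow> ((*v) (qbd_Az Am1 A0 A1 (z0 powr a)) ^^ N) (\<chi> k. u$k powr a)
        \<le> (lam ^ N - (1 - a) * \<kappa>) *\<^sub>R (\<chi> k. u$k powr a)"
    using qbd_Az_powr_iterate_deficit[OF assms] by blast
  define c where "c = \<kappa> / (real N * lam ^ (N - 1) * (z0 * ln z0))"
  have "0 < c"
    unfolding c_def using \<open>0 < N\<close> \<open>0 < \<kappa>\<close> \<open>1 < z0\<close> \<open>1 \<le> lam\<close>
    by (intro divide_pos_pos mult_pos_pos) auto
  moreover have "spectral_radius (qbd_Az Am1 A0 A1 z) \<le> lam - c * (z0 - z)"
    if "sqrt z0 \<le> z" "z < z0" for z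
  proof -
    define a where "a = ln z / ln z0"
    note exponent = log_ratio_exponent[OF \<open>1 < z0\<close> that, folded a_def]
    have "\<forall>j. u$j \<noteq> 0" using u_pos by (metis less_irrefl)
    have "spectral_radius (qbd_Az Am1 A0 A1 (z0 powr a)) ^ N \<le> lam ^ N - (1 - a) * \<kappa>"
      using spectral_radius_pow_le[OF nonneg_qbd_Az[OF nonneg] _ deficit] exponent(1,2)
        \<open>\<forall>j. u$j \<noteq> 0\<close> \<open>1 < z0\<close>
      by simp
    then have "spectral_radius (qbd_Az Am1 A0 A1 z) ^ N \<le> lam ^ N - (1 - a) * \<kappa>"
      unfolding exponent(3) .
    then have "spectral_radius (qbd_Az Am1 A0 A1 z) \<le> lam - (1 - a) * \<kappa> / (real N * lam ^ (N - 1))"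
      using exponent(2) \<open>0 < \<kappa>\<close>
      by (intro le_of_pow_le_pow_minus[OF \<open>1 \<le> lam\<close> \<open>0 < N\<close> spectral_radius_nonneg]) auto
    also have "\<dots> \<le> lam - c * (z0 - z)"
    proof -
      have "c * (z0 - z) = (z0 - z) / (z0 * ln z0) * \<kappa> / (real N * lam ^ (N - 1))"
        by (simp add: c_def field_simps)
      also have "\<dots> \<le> (1 - a) * \<kappa> / (real N * lam ^ (N - 1))"
        using \<open>0 < \<kappa>\<close> \<open>1 \<le> lam\<close>
        by (intro divide_right_mono mult_right_mono exponent(4)) auto
      finally show ?thesis by simp
    qed
    finally show ?thesis .
  qed
  ultimately show ?thesis using that by blast
qed

text \<open>If \<open>\<sigma>(z0) \<ge> 1\<close>, then left of \<open>z0\<close> the function \<open>\<sigma>\<close> stays below a line of positive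
  slope through \<open>(z0, \<sigma>(z0))\<close>, which is incompatible with \<open>\<sigma>'(z0) = 0\<close>.\<close>
lemma qbd_spectral_radius_at_critical_point_lt_1:
  fixes Am1 A0 A1 :: "real^'m^'m" and u mu :: "real^'m"
  assumes nonneg: "nonneg_mat Am1" "nonneg_mat A0" "nonneg_mat A1"
    and stoch: "\<forall>i. (\<Sum>j\<in>UNIV. Am1$i$j + A0$i$j + A1$i$j) = 1"
    and irr: "irreducible_mat (Am1 + A0 + A1)"
    and mu: "mu v* (Am1 + A0 + A1) = mu"
    and pos_rec: "mu \<bullet> ((Am1 - A1) *v (\<chi> j. 1)) > 0"
    and "1 < z0"
    and crit: "((\<lambda>z. spectral_radius (qbd_Az Am1 A0 A1 z)) has_real_derivative 0) (at z0)"
    and u_pos: "\<forall>j. 0 < u$j"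
    and eig: "qbd_Az Am1 A0 A1 z0 *v u = spectral_radius (qbd_Az Am1 A0 A1 z0) *\<^sub>R u"
  shows "spectral_radius (qbd_Az Am1 A0 A1 z0) < 1"
proof (rule ccontr)
  assume "\<not> ?thesis"
  then have "1 \<le> spectral_radius (qbd_Az Am1 A0 A1 z0)" by simp
  then obtain c where "0 < c" and rise: "\<And>z. sqrt z0 \<le> z \<Longrightarrow> z < z0 \<Longrightarrow>
      spectral_radius (qbd_Az Am1 A0 A1 z) \<le> spectral_radius (qbd_Az Am1 A0 A1 z0) - c * (z0 - z)"
    using qbd_spectral_radius_linear_rise[OF nonneg stoch irr mu pos_rec \<open>1 < z0\<close> u_pos eig]
    by blast
  have "sqrt z0 < z0"
    using \<open>1 < z0\<close> real_sqrt_less_iff[of z0 "z0\<^sup>2"] by (simp add: power2_eq_square)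
  then show False using no_linear_rise_to_critical_point[OF crit \<open>0 < c\<close> _ rise] by blast
qed

lemma qbd_eigenvalue_pos:
  fixes Am1 A0 A1 :: "real^'m^'m" and u :: "real^'m"
  assumes nonneg: "nonneg_mat Am1" "nonneg_mat A0" "nonneg_mat A1"
    and stoch: "\<forall>i. (\<Sum>j\<in>UNIV. Am1$i$j + A0$i$j + A1$i$j) = 1"
    and "0 < z" and u_pos: "\<forall>j. 0 < u$j"
    and eig: "qbd_Az Am1 A0 A1 z *v u = lam *\<^sub>R u"
  shows "0 < lam"
proof -
  fix j :: 'm
  obtain k where "0 < Am1$j$k + A0$j$k + A1$j$k"
    using stoch[rule_format, of j] sum_nonpos[of UNIV "\<lambda>k. Am1$j$k + A0$j$k + A1$j$k"]
    by (metis not_less zero_less_one)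
  then have "0 < Am1$j$k \<or> 0 < A0$j$k \<or> 0 < A1$j$k"
    by linarith
  moreover have "0 \<le> Am1$j$k / z" "0 \<le> A0$j$k" "0 \<le> z * A1$j$k"
    using nonneg \<open>0 < z\<close> by (simp_all add: nonneg_mat_def)
  ultimately have "0 < qbd_Az Am1 A0 A1 z $ j $ k"
    using \<open>0 < z\<close> unfolding qbd_Az_entry
    by (elim disjE) (simp_all add: add_pos_nonneg add_nonneg_pos)
  moreover have "0 \<le> qbd_Az Am1 A0 A1 z $ j $ i * u$i" for i
    using nonneg_qbd_Az[OF nonneg \<open>0 < z\<close>] u_pos[rule_format, of i]
    by (simp add: nonneg_mat_def)
  ultimately have "0 < (qbd_Az Am1 A0 A1 z *v u)$j"
    using u_pos unfolding matrix_vector_mult_def by (auto intro!: sum_pos2[of _ k])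
  then show ?thesis using eig u_pos[rule_format, of j] by (simp add: zero_less_mult_iff)
qed

section \<open>The geometric drift vector\<close>

lemma qbd_P_outside_neighbour_levels:
  assumes "y \<notin> {fst x - 1, fst x, fst x + 1} \<times> UNIV"
  shows "qbd_P B Am1 A0 A1 x y = 0"
  using assms by (auto simp: qbd_P_def split: prod.splits)

lemma qbd_P_row_summable_infsum:
  fixes v :: "nat \<times> 'm::finite \<Rightarrow> real" and x :: "nat \<times> 'm"
  defines "F \<equiv> {fst x - 1, fst x, fst x + 1} \<times> (UNIV :: 'm set)"
  shows "(\<lambda>y. qbd_P B Am1 A0 A1 x y * v y) summable_on UNIV"
    and "(\<Sum>\<^sub>\<infinity>y. qbd_P B Am1 A0 A1 x y * v y) = (\<Sum>y\<in>F. qbd_P B Am1 A0 A1 x y * v y)"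
proof -
  have "finite F" by (simp add: F_def)
  moreover have "qbd_P B Am1 A0 A1 x y * v y = 0" if "y \<in> UNIV - F" for y
    using that qbd_P_outside_neighbour_levels[of y x] by (simp add: F_def)
  ultimately show "(\<lambda>y. qbd_P B Am1 A0 A1 x y * v y) summable_on UNIV"
    and "(\<Sum>\<^sub>\<infinity>y. qbd_P B Am1 A0 A1 x y * v y) = (\<Sum>y\<in>F. qbd_P B Am1 A0 A1 x y * v y)"
    using summable_on_cong_neutral[of F UNIV "\<lambda>y. qbd_P B Am1 A0 A1 x y * v y"]
      infsum_cong_neutral[of F UNIV "\<lambda>y. qbd_P B Am1 A0 A1 x y * v y"]
    by auto
qed

lemma qbd_geometric_row_level_0:
  "(\<Sum>\<^sub>\<infinity>y. qbd_P B Am1 A0 A1 (0, i) y * (case y of (n, j) \<Rightarrow> z0 ^ n * u$j))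
     = (B *v u + A1 *v (z0 *\<^sub>R u))$i"
proof -
  have "{0 - 1, 0, 0 + 1} = {0, 1::nat}" by auto
  then have "(\<Sum>\<^sub>\<infinity>y. qbd_P B Am1 A0 A1 (0, i) y * (case y of (n, j) \<Rightarrow> z0 ^ n * u$j))
      = (\<Sum>k\<in>UNIV. B$i$k * u$k) + (\<Sum>k\<in>UNIV. A1$i$k * (z0 * u$k))"
    unfolding qbd_P_row_summable_infsum(2) by (simp add: sum.cartesian_product' qbd_P_def)
  also have "\<dots> = (B *v u + A1 *v (z0 *\<^sub>R u))$i"
    by (simp add: matrix_vector_mult_def)
  finally show ?thesis .
qed

lemma qbd_geometric_row_level_Suc:
  assumes "0 < z0" and eig: "qbd_Az Am1 A0 A1 z0 *v u = lam *\<^sub>R u"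
  shows "(\<Sum>\<^sub>\<infinity>y. qbd_P B Am1 A0 A1 (Suc m, i) y * (case y of (n, j) \<Rightarrow> z0 ^ n * u$j))
     = lam * (z0 ^ Suc m * u$i)"
proof -
  have "{Suc m - 1, Suc m, Suc m + 1} = {m, Suc m, Suc (Suc m)}" by auto
  then have "(\<Sum>\<^sub>\<infinity>y. qbd_P B Am1 A0 A1 (Suc m, i) y * (case y of (n, j) \<Rightarrow> z0 ^ n * u$j))
      = (\<Sum>k\<in>UNIV. Am1$i$k * (z0 ^ m * u$k)) + (\<Sum>k\<in>UNIV. A0$i$k * (z0 ^ Suc m * u$k))
        + (\<Sum>k\<in>UNIV. A1$i$k * (z0 ^ Suc (Suc m) * u$k))"
    unfolding qbd_P_row_summable_infsum(2) by (simp add: sum.cartesian_product' qbd_P_def)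
  also have "\<dots> = (\<Sum>k\<in>UNIV. z0 ^ Suc m * (qbd_Az Am1 A0 A1 z0 $ i $ k * u$k))"
    unfolding sum.distrib[symmetric] using \<open>0 < z0\<close>
    by (intro sum.cong) (simp_all add: qbd_Az_entry field_simps)
  also have "\<dots> = z0 ^ Suc m * (qbd_Az Am1 A0 A1 z0 *v u)$i"
    by (simp add: matrix_vector_mult_def sum_distrib_left)
  also have "\<dots> = lam * (z0 ^ Suc m * u$i)"
    using eig by simp
  finally show ?thesis .
qed

lemma geometric_vector_bounded_below:
  fixes u :: "real^'m"
  assumes "1 \<le> z0" "\<forall>j. 0 < u$j"
  shows "\<exists>\<epsilon>>0. \<forall>x. \<epsilon> \<le> (\<lambda>(n, j). z0 ^ n * u$j) x"
proof (intro exI conjI allI)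
  show "0 < Min (range (($) u))" using assms by simp
  fix x :: "nat \<times> 'm"
  obtain n j where x: "x = (n, j)" by force
  have "Min (range (($) u)) \<le> u$j" by simp
  also have "\<dots> \<le> z0 ^ n * u$j"
    using assms one_le_power[of z0 n] mult_right_mono[of 1 "z0 ^ n" "u$j"] by (simp add: less_imp_le)
  finally show "Min (range (($) u)) \<le> (\<lambda>(n, j). z0 ^ n * u$j) x" by (simp add: x)
qed

lemma qbd_drift_geometric:
  fixes B Am1 A0 A1 :: "real^'m^'m" and u :: "real^'m"
  assumes "1 < z0" and u_pos: "\<forall>j. 0 < u$j"
    and eig: "qbd_Az Am1 A0 A1 z0 *v u = lam *\<^sub>R u" and "0 < lam" "lam < 1"
  shows "drift_cond (qbd_P B Am1 A0 A1) (\<lambda>(n, j). z0 ^ n * u$j) lam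
           (Max (range (\<lambda>j. (B *v u + A1 *v (z0 *\<^sub>R u) - lam *\<^sub>R u)$j))) {(n, j). n = 0}"
proof -
  define v :: "nat \<times> 'm \<Rightarrow> real" where "v = (\<lambda>(n, j). z0 ^ n * u$j)"
  define b where "b = Max (range (\<lambda>j. (B *v u + A1 *v (z0 *\<^sub>R u) - lam *\<^sub>R u)$j))"
  have "\<exists>\<epsilon>>0. \<forall>x. \<epsilon> \<le> v x"
    unfolding v_def using geometric_vector_bounded_below[OF _ u_pos] \<open>1 < z0\<close> by simp
  moreover have "(\<Sum>\<^sub>\<infinity>y. qbd_P B Am1 A0 A1 x y * v y) \<le> lam * v x + b * indicator {(n, j). n = 0} x"
    for x
  proof -
    obtain n i where x: "x = (n, i)" by force
    show ?thesis
    proof (cases n)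
      case 0
      have "(\<Sum>\<^sub>\<infinity>y. qbd_P B Am1 A0 A1 x y * v y) = (B *v u + A1 *v (z0 *\<^sub>R u))$i"
        unfolding x 0 v_def by (rule qbd_geometric_row_level_0)
      moreover have "(B *v u + A1 *v (z0 *\<^sub>R u) - lam *\<^sub>R u)$i \<le> b" unfolding b_def by simp
      ultimately show ?thesis by (simp add: x 0 v_def)
    next
      case (Suc m)
      have "(\<Sum>\<^sub>\<infinity>y. qbd_P B Am1 A0 A1 x y * v y) = lam * v x"
        unfolding x Suc v_def using \<open>1 < z0\<close> by (simp add: qbd_geometric_row_level_Suc[OF _ eig])
      then show ?thesis by (simp add: x Suc)
    qed
  qed
  moreover have "finite {(n::nat, j::'m). n = 0}"
    by (simp add: finite_subset[of _ "{0} \<times> UNIV"] subset_iff)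
  ultimately show ?thesis
    using \<open>0 < lam\<close> \<open>lam < 1\<close> qbd_P_row_summable_infsum(1)
    unfolding drift_cond_def v_def b_def by blast
qed

theorem lemma3p1:
  fixes B Am1 A0 A1 :: "real^'m^'m"
    and mu :: "real^'m"
    and z0 :: real
    and u :: "real^'m"
  assumes nonneg: "nonneg_mat B" "nonneg_mat Am1" "nonneg_mat A0" "nonneg_mat A1"
    and stoch0: "\<forall>i. (\<Sum>j\<in>UNIV. B$i$j + A1$i$j) = 1"
    and stoch: "\<forall>i. (\<Sum>j\<in>UNIV. Am1$i$j + A0$i$j + A1$i$j) = 1"
    and irr_chain: "irreducible_chain (qbd_P B Am1 A0 A1)"
    and irr_A: "irreducible_mat (Am1 + A0 + A1)"
    and mu_stat: "mu v* (Am1 + A0 + A1) = mu" "\<forall>j. 0 \<le> mu$j" "(\<Sum>j\<in>UNIV. mu$j) = 1"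
    and pos_rec: "mu \<bullet> ((Am1 - A1) *v (\<chi> j. 1)) > 0"
    and z0_gt: "1 < z0"
    and z0_crit: "((\<lambda>z. spectral_radius (qbd_Az Am1 A0 A1 z)) has_real_derivative 0) (at z0)"
    and z0_min: "\<forall>z. 1 < z \<and> z < z0 \<longrightarrow>
                   \<not> ((\<lambda>z. spectral_radius (qbd_Az Am1 A0 A1 z)) has_real_derivative 0) (at z)"
    and u_pos: "\<forall>j. 0 < u$j"
    and u_eig: "qbd_Az Am1 A0 A1 z0 *v u = spectral_radius (qbd_Az Am1 A0 A1 z0) *\<^sub>R u"
  shows "drift_cond (qbd_P B Am1 A0 A1)
           (\<lambda>(n, j). z0 ^ n * u$j)
           (spectral_radius (qbd_Az Am1 A0 A1 z0))
           (Max (range (\<lambda>j. (B *v u + A1 *v (z0 *\<^sub>R u)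
                                - spectral_radius (qbd_Az Am1 A0 A1 z0) *\<^sub>R u)$j)))
           {(n, j). n = 0}"
proof -
  have "spectral_radius (qbd_Az Am1 A0 A1 z0) < 1"
    by (rule qbd_spectral_radius_at_critical_point_lt_1
        [OF nonneg(2-4) stoch irr_A mu_stat(1) pos_rec z0_gt z0_crit u_pos u_eig])
  moreover have "0 < spectral_radius (qbd_Az Am1 A0 A1 z0)"
    using qbd_eigenvalue_pos[OF nonneg(2-4) stoch _ u_pos u_eig] z0_gt by simp
  ultimately show ?thesis
    using qbd_drift_geometric[OF z0_gt u_pos u_eig] by blast
qed

end
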